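(* Let $D\subseteq X$ be a nonempty convex set, let $A,B:(D-D)\to\mathscr{P}_0(Y)$ be set-valued maps, and put $K:=\overline{\mathrm{rec}}(B)$. Let $F:D\to\mathscr{P}_0(Y)$ be a set-valued map which satisfies $$F\Big(\frac{x+y}{2}\Big)+A(x-y)\subseteq \mathrm{cl}\Big(\frac{F(x)+F(y)}{2}+B(x-y)\Big)\qquad (x,y\in D).$$ Assume in addition that: (i) for all $x\in D$, $F(x)$ is closedly $K$-convex, closedly $K$-starshaped with respect to some element of $Y$, and also closedly $K$-lower bounded; (ii) $F$ is directionally $K$-upper semicontinuous on $D$ (i.e. at every point of $D$); (iii) for all $u\in D-D$, the sets $A(u)$ and $B(u)$ are closedly $K$-starshaped and closedly $K$-lower bounded, and $B(u)$ is also closedly $K$-convex; (iv) for all $u\in D-D$, the sequences $\big(A\big(\frac{u}{2^k}\big)\big)_{k\ge 0}$ and $\big(B\big(\frac{u}{2^k}\big)\big)_{k\ge 0}$ are serially $K$-Cauchy. Then $$F(tx+(1-t)y)+A^\perp(t,x-y)\subseteq \mathrm{cl}\big(tF(x)+(1-t)F(y)+B^\perp(t,x-y)+K\big)\qquad (x,y\in D,\ t\in[0,1]).$$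
   Context: $X$ is a real linear space and $Y$ is a real Hausdorff topological vector space. $\mathscr{P}_0(Y)$ is the family of nonempty subsets of $Y$; $\mathscr{U}(Y)$ is a base of balanced neighborhoods of zero in $Y$; $\mathrm{cl}$ is the closure in $Y$. Sums and scalar multiples of sets are in the Minkowski sense (so $0\cdot S=\{0\}$ for nonempty $S$), and $D-D=\{x-y: x,y\in D\}$. Recession cones: for nonempty $S\subseteq Y$, $\mathrm{rec}(S):=\{y\in Y: ty+S\subseteq S \text{ for all } t\ge 0\}$. For a set-valued map $B$ on $D-D$, $\mathrm{rec}(B):=\bigcap_{u\in D-D}\mathrm{rec}(B(u))$, and $\overline{\mathrm{rec}}(B)$ is the closure of $\mathrm{rec}(B)$ (a convex cone containing $0$). For a convex cone $K\subseteq Y$: a set $S\subseteq Y$ is closedly $K$-convex if $tS+(1-t)S\subseteq\mathrm{cl}(S+K)$ for all $t\in[0,1]$; it is closedly $K$-starshaped with respect to $y\in Y$ if $tS+(1-t)y\subseteq\mathrm{cl}(S+K)$ for all $t\in[0,1]$; it is closedly $K$-starshaped if it is so with respect to $y=0$. A set $H\subseteq Y$ is bounded if for every $U\in\mathscr{U}(Y)$ there is $t>0$ with $tH\subseteq U$. $S$ is closedly $K$-lower bounded if there is a bounded $H\subseteq Y$ with $S\subseteq\mathrm{cl}(H+K)$. A sequence $(S_k)$ of subsets of $Y$ is serially $K$-Cauchy if for all $U\in\mathscr{U}(Y)$ there exists $m\in\mathbb{N}$ such that $\sum_{k=m}^n S_k\subseteq U+K$ for all $n\ge m$. $F:D\to\mathscr{P}_0(Y)$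 is directionally $K$-upper semicontinuous at $p\in D$ if for every $h\in X$ and every $U\in\mathscr{U}(Y)$ there is $\delta>0$ such that $F(p+th)\subseteq F(p)+U+K$ for all $0<t<\delta$ with $p+th\in D$. Tabor transformation: with $d_{\mathbb{Z}}(t):=\inf_{k\in\mathbb{Z}}|k-t|$, for a set-valued map $S:D-D\to\mathscr{P}_0(Y)$, $$S^\perp(t,u):=\mathrm{cl}\Big(\bigcup_{n=0}^\infty\sum_{k=0}^n 2d_{\mathbb{Z}}(2^kt)\,S\Big(\frac{u}{2^k}\Big)\Big)\qquad (t\in\mathbb{R},\ u\in D-D).$$ *)

theory Defs
  imports "HOL-Analysis.Analysis"
begin

text \<open>
  Sums \<open>S + T\<close> and \<open>\<Sum>k\<in>I. S k\<close> of sets are the Minkowski sums of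
  \<^theory>\<open>HOL-Library.Set_Algebras\<close>, and \<open>t S\<close> is written \<open>(*\<^sub>R) t ` S\<close>.
  The operation \<open>S - T\<close> on sets is the set-theoretic difference, so the algebraic
  difference \<open>D - D\<close> needs a name of its own.
\<close>

class hausdorff_tvs = real_vector + topological_ab_group_add + t2_space +
  assumes tendsto_scaleR_nhds:
    "LIM p (nhds c \<times>\<^sub>F nhds x). fst p *\<^sub>R snd p :> nhds (c *\<^sub>R x)"

instance real_normed_vector \<subseteq> hausdorff_tvs
proof
  fix c :: real and x :: 'a
  have "(fst \<longlongrightarrow> c) (nhds c \<times>\<^sub>F nhds x)"
    by (rule filterlim_fst)
  moreover have "(snd \<longlongrightarrow> x) (nhds c \<times>\<^sub>F nhds x)"
    by (rule filterlim_snd)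
  ultimately show "LIM p (nhds c \<times>\<^sub>F nhds x). fst p *\<^sub>R snd p :> nhds (c *\<^sub>R x)"
    by (rule tendsto_scaleR)
qed

definition self_difference :: "'a::real_vector set \<Rightarrow> 'a set" where
  "self_difference D = {x - y |x y. x \<in> D \<and> y \<in> D}"

definition balanced :: "'b::real_vector set \<Rightarrow> bool" where
  "balanced V \<longleftrightarrow> (\<forall>c. \<bar>c\<bar> \<le> 1 \<longrightarrow> (*\<^sub>R) c ` V \<subseteq> V)"

text \<open>
  The members of a neighbourhood base need not be open. The notions below that depend on
  a base take it as a parameter \<open>\<U>\<close>.
\<close>

definition balanced_zero_nhds_base :: "'b::hausdorff_tvs set set \<Rightarrow> bool" where
  "balanced_zero_nhds_base \<U> \<longleftrightarrow>
     (\<forall>V\<in>\<U>. 0 \<in> interior V \<and> balanced V) \<and>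
     (\<forall>W. 0 \<in> interior W \<longrightarrow> (\<exists>V\<in>\<U>. V \<subseteq> W))"

definition rec_cone :: "'b::real_vector set \<Rightarrow> 'b set" where
  "rec_cone S = {y. \<forall>t\<ge>0. {t *\<^sub>R y} + S \<subseteq> S}"

definition rec_map :: "'a set \<Rightarrow> ('a \<Rightarrow> 'b::real_vector set) \<Rightarrow> 'b set" where
  "rec_map E B = (\<Inter>u\<in>E. rec_cone (B u))"

definition closedly_convex :: "'b::hausdorff_tvs set \<Rightarrow> 'b set \<Rightarrow> bool" where
  "closedly_convex K S \<longleftrightarrow>
     (\<forall>t\<in>{0..1}. (*\<^sub>R) t ` S + (*\<^sub>R) (1 - t) ` S \<subseteq> closure (S + K))"

definition closedly_starshaped_wrt :: "'b::hausdorff_tvs set \<Rightarrow> 'b set \<Rightarrow> 'b \<Rightarrow> bool" where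
  "closedly_starshaped_wrt K S y \<longleftrightarrow>
     (\<forall>t\<in>{0..1}. (*\<^sub>R) t ` S + {(1 - t) *\<^sub>R y} \<subseteq> closure (S + K))"

definition closedly_starshaped :: "'b::hausdorff_tvs set \<Rightarrow> 'b set \<Rightarrow> bool" where
  "closedly_starshaped K S \<longleftrightarrow> closedly_starshaped_wrt K S 0"

definition tvs_bounded :: "'b::hausdorff_tvs set set \<Rightarrow> 'b set \<Rightarrow> bool" where
  "tvs_bounded \<U> H \<longleftrightarrow> (\<forall>U\<in>\<U>. \<exists>t>0. (*\<^sub>R) t ` H \<subseteq> U)"

definition closedly_lower_bounded ::
    "'b::hausdorff_tvs set set \<Rightarrow> 'b set \<Rightarrow> 'b set \<Rightarrow> bool" where
  "closedly_lower_bounded \<U> K S \<longleftrightarrow> (\<exists>H. tvs_bounded \<U> H \<and> S \<subseteq> closure (H + K))"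

definition serially_Cauchy ::
    "'b::hausdorff_tvs set set \<Rightarrow> 'b set \<Rightarrow> (nat \<Rightarrow> 'b set) \<Rightarrow> bool" where
  "serially_Cauchy \<U> K S \<longleftrightarrow> (\<forall>U\<in>\<U>. \<exists>m. \<forall>n\<ge>m. (\<Sum>k=m..n. S k) \<subseteq> U + K)"

definition directionally_usc_at ::
    "'b::hausdorff_tvs set set \<Rightarrow> 'b set \<Rightarrow> 'a::real_vector set \<Rightarrow> ('a \<Rightarrow> 'b set) \<Rightarrow> 'a \<Rightarrow> bool" where
  "directionally_usc_at \<U> K D F p \<longleftrightarrow>
     (\<forall>h. \<forall>U\<in>\<U>. \<exists>\<delta>>0. \<forall>t. 0 < t \<and> t < \<delta> \<and> p + t *\<^sub>R h \<in> D \<longrightarrow>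
        F (p + t *\<^sub>R h) \<subseteq> F p + U + K)"

definition dist_int :: "real \<Rightarrow> real" where
  "dist_int t = (INF k::int. \<bar>of_int k - t\<bar>)"

definition tabor_transform ::
    "('a::real_vector \<Rightarrow> 'b::hausdorff_tvs set) \<Rightarrow> real \<Rightarrow> 'a \<Rightarrow> 'b set" where
  "tabor_transform S t u =
     closure (\<Union>n. \<Sum>k=0..n. (*\<^sub>R) (2 * dist_int (2 ^ k * t)) ` S (u /\<^sub>R 2 ^ k))"

end

theory Submission
  imports Defs
begin

text \<open>
  At a dyadic \<open>t\<close> of level \<open>n + 1\<close> the inclusion follows from the two neighbours of level
  \<open>n\<close>: every weight \<open>2 d(2\<^sup>k t)\<close> with \<open>k < n\<close> is affine between them, and
  \<open>2 d(2\<^sup>n t) = 1\<close>. For general \<open>t < 1\<close>, semicontinuity points the wrong way to pass from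
  dyadic points to \<open>t\<close>. Instead, \<open>t\<close> is placed in a dyadic cell \<open>[s0, s1]\<close> with \<open>s1 < 1\<close>, and
  the grid inside the cell is shifted by a small \<open>d \<ge> 0\<close> so that \<open>t\<close> becomes a grid point.
  The dyadic case between the shifted end points bounds \<open>F\<close> at \<open>t\<close>, semicontinuity at \<open>s0\<close> and
  \<open>s1\<close> removes the shift from the end points, and the dyadic case applies again at \<open>s0\<close> and
  \<open>s1\<close>. Starshapedness and lower boundedness make the scalar multiples continuous as
  \<open>d \<rightarrow> 0\<close>.
\<close>

abbreviation (input) set_scaleR :: "real \<Rightarrow> 'b::real_vector set \<Rightarrow> 'b set" (infixr "\<cdot>" 75) where
  "c \<cdot> S \<equiv> (*\<^sub>R) c ` S"

section \<open>Minkowski operations\<close>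

text \<open>Keeping \<open>0\<close> folded lets the neutral element laws of Minkowski addition
  fire; it is unfolded to \<open>{0}\<close> only on request.\<close>

declare set_zero [simp del]

lemma scale_set_plus: "c \<cdot> (S + T) = c \<cdot> S + c \<cdot> T"
  by (force simp: set_plus_def scaleR_add_right image_iff)

lemma scale_set_zero: "c \<cdot> (0::'b::real_vector set) = 0"
  by (simp add: set_zero)

lemma scale_set_sum: "c \<cdot> (\<Sum>k\<in>I. S k) = (\<Sum>k\<in>I. c \<cdot> S k)"
  by (induction I rule: infinite_finite_induct)
    (auto simp: scale_set_plus scale_set_zero)

lemma scale_scale_set: "c \<cdot> d \<cdot> S = (c * d) \<cdot> S"
  by (simp add: image_image)

text \<open>Only this inclusion holds for every set. The reverse one, for nonnegative coefficients
  and up to closure and cone, is \<open>convex_dominated\<close>. Hence coefficients are split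
  freely on the side of \<open>A\<close>, while merging them for \<open>F\<close> and
  \<open>B\<close> uses convexity.\<close>

lemma scale_set_add_subset: "(c + d) \<cdot> S \<subseteq> c \<cdot> S + d \<cdot> S"
  by (auto simp: scaleR_add_left)

lemma zero_scale_set: "S \<noteq> {} \<Longrightarrow> 0 \<cdot> S = 0"
  by (auto simp: set_zero)

lemma set_sum_mono:
  fixes S T :: "'i \<Rightarrow> 'b::comm_monoid_add set"
  assumes "\<And>k. k \<in> I \<Longrightarrow> S k \<subseteq> T k"
  shows "(\<Sum>k\<in>I. S k) \<subseteq> (\<Sum>k\<in>I. T k)"
  using assms
  by (induction I rule: infinite_finite_induct) (simp_all add: set_plus_mono2)

lemma subset_set_plus_left: "0 \<in> T \<Longrightarrow> S \<subseteq> S + (T::'b::comm_monoid_add set)"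
  by (metis add.right_neutral set_plus_intro subsetI)

section \<open>Topological vector spaces\<close>

lemma tendsto_scaleR_tvs:
  fixes g :: "'i \<Rightarrow> 'b::hausdorff_tvs"
  assumes "(f \<longlongrightarrow> c) F" "(g \<longlongrightarrow> x) F"
  shows "((\<lambda>i. f i *\<^sub>R g i) \<longlongrightarrow> c *\<^sub>R x) F"
  using filterlim_compose[OF tendsto_scaleR_nhds filterlim_Pair[OF assms]] by simp

text \<open>Addition is continuous on the product, and the closure of a product is the product of
  the closures.\<close>

lemma closure_set_plus_subset:
  fixes S T :: "'b::hausdorff_tvs set"
  shows "closure S + closure T \<subseteq> closure (S + T)"
proof -
  have "(\<lambda>p. fst p + snd p) ` closure (S \<times> T) \<subseteq> closure (S + T)"
    by (rule image_closure_subset)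
      (auto intro!: continuous_intros closure_subset[THEN subsetD] set_plus_intro)
  then show ?thesis
    by (force simp: closure_Times set_plus_def)
qed

lemma closure_scale_subset:
  fixes S :: "'b::hausdorff_tvs set"
  shows "c \<cdot> closure S \<subseteq> closure (c \<cdot> S)"
proof (rule image_closure_subset)
  show "continuous_on (closure S) ((*\<^sub>R) c)"
    unfolding continuous_on_def by (auto intro!: tendsto_scaleR_tvs tendsto_const tendsto_ident_at)
qed (auto intro: closure_subset[THEN subsetD])

section \<open>Convex cones and balanced neighbourhoods of zero\<close>

locale tvs_cone =
  fixes \<U> :: "'b::hausdorff_tvs set set" and K :: "'b set"
  assumes base: "balanced_zero_nhds_base \<U>"
    and zero_mem: "0 \<in> K"
    and add_mem: "x \<in> K \<Longrightarrow> y \<in> K \<Longrightarrow> x + y \<in> K"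
    and scale_mem: "0 \<le> c \<Longrightarrow> x \<in> K \<Longrightarrow> c *\<^sub>R x \<in> K"
begin

lemma K_plus_K: "K + K \<subseteq> K"
  by (auto simp: set_plus_def add_mem)

lemma scale_K: "0 \<le> c \<Longrightarrow> c \<cdot> K \<subseteq> K"
  by (auto simp: scale_mem)

lemma base_interior: "U \<in> \<U> \<Longrightarrow> 0 \<in> interior U"
  using base by (auto simp: balanced_zero_nhds_base_def)

lemma base_zero: "U \<in> \<U> \<Longrightarrow> 0 \<in> U"
  using base_interior interior_subset by blast

lemma base_scale: "U \<in> \<U> \<Longrightarrow> \<bar>c\<bar> \<le> 1 \<Longrightarrow> c \<cdot> U \<subseteq> U"
  using base by (auto simp: balanced_zero_nhds_base_def balanced_def)

lemma base_refine: "0 \<in> interior W \<Longrightarrow> \<exists>V\<in>\<U>. V \<subseteq> W"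
  using base by (auto simp: balanced_zero_nhds_base_def)

lemma base_eventually:
  assumes "U \<in> \<U>" "(f \<longlongrightarrow> 0) G"
  shows "\<forall>\<^sub>F i in G. f i \<in> U"
  using topological_tendstoD[OF assms(2) open_interior base_interior[OF assms(1)]]
  by eventually_elim (use interior_subset in blast)

text \<open>Continuity of addition at the origin gives one neighbourhood for each summand; a member
  of the base inside both serves for the two.\<close>

lemma base_split:
  assumes "U \<in> \<U>"
  obtains V where "V \<in> \<U>" "V + V \<subseteq> U"
proof -
  have "((\<lambda>p. fst p + snd p) \<longlongrightarrow> 0 + 0) (nhds (0::'b) \<times>\<^sub>F nhds 0)"
    by (intro tendsto_add filterlim_fst filterlim_snd)
  then have "\<forall>\<^sub>F p in nhds (0::'b) \<times>\<^sub>F nhds 0. fst p + snd p \<in> U"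
    using base_eventually[OF assms] by simp
  then obtain P Q where P: "eventually P (nhds (0::'b))" and Q: "eventually Q (nhds (0::'b))"
    and PQ: "\<And>x y. P x \<Longrightarrow> Q y \<Longrightarrow> x + y \<in> U"
    by (auto simp: eventually_prod_filter)
  from eventually_conj[OF P Q] obtain W where W: "open W" "0 \<in> W" "\<And>x. x \<in> W \<Longrightarrow> P x \<and> Q x"
    by (auto simp: eventually_nhds)
  then obtain V where V: "V \<in> \<U>" "V \<subseteq> W"
    using base_refine[of W] by (auto simp: interior_open)
  have "V + V \<subseteq> U"
    using PQ V W(3) unfolding set_plus_def by blast
  with V that show ?thesis by blast
qed

text \<open>This preorder carries the argument: it respects sums and nonnegative multiples, so
  inclusions up to closure and cone can be chained like inequalities. Closed convexity,
  starshapedness and lower boundedness are all stated through it.\<close>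

definition dominated :: "'b set \<Rightarrow> 'b set \<Rightarrow> bool" (infix "\<preceq>" 50) where
  "S \<preceq> T \<longleftrightarrow> S \<subseteq> closure (T + K)"

lemma subset_dominated: "S \<subseteq> T \<Longrightarrow> S \<preceq> T"
  unfolding dominated_def
  using closure_subset subset_set_plus_left[OF zero_mem] by blast

lemma dominated_refl: "S \<preceq> S"
  by (simp add: subset_dominated)

lemma subset_plus_K_dominated: "S \<subseteq> T + K \<Longrightarrow> S \<preceq> T"
  unfolding dominated_def using closure_subset by blast

lemma dominated_add:
  assumes "S \<preceq> T" "S' \<preceq> T'"
  shows "S + S' \<preceq> T + T'"
proof -
  have "S + S' \<subseteq> closure (T + K) + closure (T' + K)"
    using assms unfolding dominated_def by (rule set_plus_mono2)
  also have "\<dots> \<subseteq> closure ((T + K) + (T' + K))"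
    by (rule closure_set_plus_subset)
  also have "(T + K) + (T' + K) = (T + T') + (K + K)"
    by (simp add: ac_simps)
  also have "closure \<dots> \<subseteq> closure (T + T' + K)"
    by (intro closure_mono set_plus_mono2 K_plus_K order_refl)
  finally show ?thesis unfolding dominated_def .
qed

text \<open>Since \<open>K\<close> is dominated by \<open>0\<close>, the set \<open>T + K\<close> is
  dominated by \<open>R\<close>. The closure of \<open>R + K\<close> is closed, so it also contains
  the closure of \<open>T + K\<close>.\<close>

lemma dominated_trans [trans]:
  assumes "S \<preceq> T" "T \<preceq> R"
  shows "S \<preceq> R"
proof -
  have "T + K \<preceq> R + 0"
    by (intro dominated_add assms(2) subset_plus_K_dominated) simp
  then have "closure (T + K) \<subseteq> closure (R + K)"
    unfolding dominated_def by (simp add: closure_minimal)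
  then show ?thesis using assms(1) unfolding dominated_def by blast
qed

lemma dominated_scale:
  assumes "S \<preceq> T" "0 \<le> c"
  shows "c \<cdot> S \<preceq> c \<cdot> T"
proof -
  have "c \<cdot> S \<subseteq> c \<cdot> closure (T + K)"
    using assms(1) unfolding dominated_def by (rule image_mono)
  also have "\<dots> \<subseteq> closure (c \<cdot> (T + K))"
    by (rule closure_scale_subset)
  also have "\<dots> \<subseteq> closure (c \<cdot> T + K)"
    unfolding scale_set_plus by (intro closure_mono set_plus_mono2 scale_K assms order_refl)
  finally show ?thesis unfolding dominated_def .
qed

lemma dominated_sum:
  assumes "\<And>k. k \<in> I \<Longrightarrow> S k \<preceq> T k"
  shows "(\<Sum>k\<in>I. S k) \<preceq> (\<Sum>k\<in>I. T k)"
  using assms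
  by (induction I rule: infinite_finite_induct) (auto intro!: dominated_refl dominated_add)

lemma dominated_sum_superset:
  assumes "finite J" "I \<subseteq> J" "\<And>k. k \<in> J - I \<Longrightarrow> 0 \<preceq> S k"
  shows "(\<Sum>k\<in>I. S k) \<preceq> (\<Sum>k\<in>J. S k)"
proof -
  have "(\<Sum>k\<in>J - I. 0) \<preceq> (\<Sum>k\<in>J - I. S k)"
    using assms(3) by (rule dominated_sum)
  then have "0 + (\<Sum>k\<in>I. S k) \<preceq> (\<Sum>k\<in>J - I. S k) + (\<Sum>k\<in>I. S k)"
    by (intro dominated_add dominated_refl) simp
  then show ?thesis
    using sum.subset_diff[OF assms(2,1), of S] by simp
qed

text \<open>For \<open>a + b > 0\<close> the defining inclusion at \<open>t = a / (a + b)\<close> is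
  multiplied by \<open>a + b\<close>.\<close>

lemma convex_dominated:
  assumes "closedly_convex K S" "0 \<le> a" "0 \<le> b"
  shows "a \<cdot> S + b \<cdot> S \<preceq> (a + b) \<cdot> S"
proof (cases "a + b = 0")
  case True
  \<comment> \<open>Both coefficients vanish. An empty \<open>S\<close> is treated apart because
    \<open>zero_scale_set\<close> needs a point of \<open>S\<close>.\<close>
  with assms have "a = 0" "b = 0" by auto
  moreover have "0 \<cdot> S + 0 \<cdot> S \<preceq> 0 \<cdot> S"
    using zero_scale_set[of S] dominated_refl by (cases "S = {}") force+
  ultimately show ?thesis by simp
next
  case False
  define t where "t = a / (a + b)"
  have t: "t \<in> {0..1}" "(a + b) * t = a" "(a + b) * (1 - t) = b"
    using assms False by (auto simp: t_def field_simps)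
  have "t \<cdot> S + (1 - t) \<cdot> S \<preceq> S"
    using assms(1) t(1) by (auto simp: closedly_convex_def dominated_def)
  then have "(a + b) \<cdot> (t \<cdot> S + (1 - t) \<cdot> S) \<preceq> (a + b) \<cdot> S"
    using assms by (intro dominated_scale) auto
  then show ?thesis
    by (simp only: scale_set_plus scale_scale_set t)
qed

lemma starshaped_dominated:
  assumes "closedly_starshaped K S" "0 \<le> c" "c \<le> 1"
  shows "c \<cdot> S \<preceq> S"
  using assms
  by (auto simp: closedly_starshaped_def closedly_starshaped_wrt_def dominated_def
      simp flip: set_zero)

text \<open>Shrinking a nonempty set by the factor \<open>0\<close> leaves \<open>{0}\<close>. It
  follows that extra terms with nonnegative coefficients only enlarge a sum in the sense of
  \<open>\<preceq>\<close>.\<close>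

lemma starshaped_zero_dominated:
  assumes "closedly_starshaped K S" "S \<noteq> {}" "0 \<le> c"
  shows "0 \<preceq> c \<cdot> S"
proof -
  have "0 \<preceq> S"
    using starshaped_dominated[OF assms(1), of 0] zero_scale_set[OF assms(2)] by simp
  from dominated_scale[OF this assms(3)] show ?thesis
    by (simp add: scale_set_zero)
qed

section \<open>Asymptotic domination\<close>

text \<open>A one-sided comparison takes the place of limits of sets: every base neighbourhood
  eventually contains the error. Sums, compositions and multiples by factors from
  \<open>[0, 1]\<close> preserve it.\<close>

definition asymp_dominated :: "(nat \<Rightarrow> 'b set) \<Rightarrow> (nat \<Rightarrow> 'b set) \<Rightarrow> bool" where
  "asymp_dominated S T \<longleftrightarrow> (\<forall>U\<in>\<U>. \<forall>\<^sub>F n in sequentially. S n \<preceq> T n + U)"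

lemma asymp_dominatedI:
  assumes "\<forall>\<^sub>F n in sequentially. S n \<preceq> T n"
  shows "asymp_dominated S T"
  unfolding asymp_dominated_def
proof
  fix U assume "U \<in> \<U>"
  then have "T n \<preceq> T n + U" for n
    by (intro subset_dominated subset_set_plus_left base_zero)
  then show "\<forall>\<^sub>F n in sequentially. S n \<preceq> T n + U"
    using assms by (auto elim!: eventually_mono intro: dominated_trans)
qed

lemma asymp_dominated_refl: "asymp_dominated S S"
  by (simp add: asymp_dominatedI dominated_refl)

lemma asymp_dominated_add:
  assumes "asymp_dominated S T" "asymp_dominated S' T'"
  shows "asymp_dominated (\<lambda>n. S n + S' n) (\<lambda>n. T n + T' n)"
  unfolding asymp_dominated_def
proof
  fix U assume "U \<in> \<U>"
  then obtain V where V: "V \<in> \<U>" "V + V \<subseteq> U" by (rule base_split)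
  have "\<forall>\<^sub>F n in sequentially. S n \<preceq> T n + V" "\<forall>\<^sub>F n in sequentially. S' n \<preceq> T' n + V"
    using assms V(1) by (auto simp: asymp_dominated_def)
  then show "\<forall>\<^sub>F n in sequentially. S n + S' n \<preceq> T n + T' n + U"
  proof eventually_elim
    case (elim n)
    have "S n + S' n \<preceq> (T n + V) + (T' n + V)"
      using elim by (rule dominated_add)
    also have "(T n + V) + (T' n + V) = (T n + T' n) + (V + V)"
      by (simp add: ac_simps)
    also have "\<dots> \<preceq> T n + T' n + U"
      by (intro subset_dominated set_plus_mono2 order_refl V)
    finally show ?case .
  qed
qed

lemma asymp_dominated_trans [trans]:
  assumes "asymp_dominated S T" "asymp_dominated T R"
  shows "asymp_dominated S R"
  unfolding asymp_dominated_def
proof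
  fix U assume "U \<in> \<U>"
  then obtain V where V: "V \<in> \<U>" "V + V \<subseteq> U" by (rule base_split)
  have "\<forall>\<^sub>F n in sequentially. S n \<preceq> T n + V" "\<forall>\<^sub>F n in sequentially. T n \<preceq> R n + V"
    using assms V(1) by (auto simp: asymp_dominated_def)
  then show "\<forall>\<^sub>F n in sequentially. S n \<preceq> R n + U"
  proof eventually_elim
    case (elim n)
    note elim(1)
    also have "T n + V \<preceq> (R n + V) + V"
      using elim(2) by (intro dominated_add dominated_refl)
    also have "(R n + V) + V = R n + (V + V)"
      by (simp add: ac_simps)
    also have "\<dots> \<preceq> R n + U"
      by (intro subset_dominated set_plus_mono2 order_refl V)
    finally show ?case .
  qed
qed

lemma asymp_dominated_sum:
  assumes "\<And>k. k \<in> I \<Longrightarrow> asymp_dominated (S k) (T k)"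
  shows "asymp_dominated (\<lambda>n. \<Sum>k\<in>I. S k n) (\<lambda>n. \<Sum>k\<in>I. T k n)"
  using assms
  by (induction I rule: infinite_finite_induct)
    (auto intro!: asymp_dominated_refl asymp_dominated_add)

text \<open>The coefficients may vary with \<open>n\<close>; since they stay in
  \<open>[0, 1]\<close>, the balanced set \<open>U\<close> absorbs the scaled error.\<close>

lemma asymp_dominated_scale:
  assumes "asymp_dominated S T" "\<And>n. 0 \<le> c n" "\<And>n. c n \<le> 1"
  shows "asymp_dominated (\<lambda>n. c n \<cdot> S n) (\<lambda>n. c n \<cdot> T n)"
  unfolding asymp_dominated_def
proof
  fix U assume U: "U \<in> \<U>"
  then have "\<forall>\<^sub>F n in sequentially. S n \<preceq> T n + U"
    using assms by (auto simp: asymp_dominated_def)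
  then show "\<forall>\<^sub>F n in sequentially. c n \<cdot> S n \<preceq> c n \<cdot> T n + U"
  proof eventually_elim
    case (elim n)
    have "c n \<cdot> S n \<preceq> c n \<cdot> (T n + U)"
      using elim assms(2) by (rule dominated_scale)
    also have "\<dots> \<preceq> c n \<cdot> T n + U"
      unfolding scale_set_plus using assms U
      by (intro subset_dominated set_plus_mono2 base_scale) auto
    finally show ?case .
  qed
qed

text \<open>A point lying in the closure of \<open>T + U + K\<close> for every base neighbourhood
  \<open>U\<close> lies in the closure of \<open>T + K\<close>, as the error from \<open>U\<close>
  can be subtracted again.\<close>

lemma asymp_dominated_const:
  assumes "asymp_dominated (\<lambda>n. S) (\<lambda>n. T)"
  shows "S \<preceq> T"
  unfolding dominated_def
proof
  fix x assume "x \<in> S"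
  have approx: "x \<in> closure (T + U + K)" if "U \<in> \<U>" for U
    using assms that \<open>x \<in> S\<close> by (auto simp: asymp_dominated_def dominated_def)
  show "x \<in> closure (T + K)"
    unfolding closure_iff_nhds_not_empty
  proof (intro allI impI)
    fix A W assume "W \<subseteq> A" "open W" "x \<in> W"
    \<comment> \<open>Continuity of subtraction at \<open>(x, 0)\<close> yields neighbourhoods
      \<open>X\<close> of \<open>x\<close> and \<open>Z\<close> of \<open>0\<close> whose
      differences all lie in \<open>W\<close>. A point of \<open>X\<close> minus its error
      \<open>u\<close> is then a point of \<open>T + K\<close> in \<open>W\<close>.\<close>
    have "((\<lambda>p. fst p - snd p) \<longlongrightarrow> x - 0) (nhds x \<times>\<^sub>F nhds 0)"
      by (intro tendsto_diff filterlim_fst filterlim_snd)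
    then have "\<forall>\<^sub>F p in nhds x \<times>\<^sub>F nhds 0. fst p - snd p \<in> W"
      using topological_tendstoD \<open>open W\<close> \<open>x \<in> W\<close> by fastforce
    then obtain P Q where P: "eventually P (nhds x)" and Q: "eventually Q (nhds (0::'b))"
      and PQ: "\<And>y z. P y \<Longrightarrow> Q z \<Longrightarrow> y - z \<in> W"
      by (auto simp: eventually_prod_filter)
    obtain X where X: "open X" "x \<in> X" "\<And>y. y \<in> X \<Longrightarrow> P y"
      using P by (auto simp: eventually_nhds)
    obtain Z where Z: "open Z" "0 \<in> Z" "\<And>z. z \<in> Z \<Longrightarrow> Q z"
      using Q by (auto simp: eventually_nhds)
    then obtain U where U: "U \<in> \<U>" "U \<subseteq> Z"
      using base_refine[of Z] by (auto simp: interior_open)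
    have "(T + U + K) \<inter> X \<noteq> {}"
      using approx[OF U(1)] X(1,2) by (auto simp: closure_iff_nhds_not_empty)
    then obtain \<tau> u \<kappa> where mem: "\<tau> \<in> T" "u \<in> U" "\<kappa> \<in> K" "\<tau> + u + \<kappa> \<in> X"
      by (auto simp: set_plus_def)
    then have "(\<tau> + u + \<kappa>) - u \<in> W"
      using PQ X Z U by blast
    then have "\<tau> + \<kappa> \<in> W" by (simp add: algebra_simps)
    moreover have "\<tau> + \<kappa> \<in> T + K" using mem by (intro set_plus_intro)
    ultimately show "(T + K) \<inter> A \<noteq> {}" using \<open>W \<subseteq> A\<close> by blast
  qed
qed

section \<open>Bounded sets and continuity of scalar multiples\<close>

lemma bounded_eventually_subset:
  assumes "tvs_bounded \<U> H" "U \<in> \<U>" "c \<longlonglongrightarrow> (0::real)"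
  shows "\<forall>\<^sub>F n in sequentially. c n \<cdot> H \<subseteq> U"
proof -
  obtain \<tau> where \<tau>: "\<tau> > 0" "\<tau> \<cdot> H \<subseteq> U"
    using assms by (auto simp: tvs_bounded_def)
  have "\<forall>\<^sub>F n in sequentially. \<bar>c n\<bar> < \<tau>"
    using tendstoD[OF assms(3) \<tau>(1)] by (simp add: dist_real_def)
  then show ?thesis
  proof eventually_elim
    case (elim n)
    have "c n \<cdot> H = (c n / \<tau>) \<cdot> \<tau> \<cdot> H"
      using \<tau> by (simp add: scale_scale_set)
    also have "\<dots> \<subseteq> (c n / \<tau>) \<cdot> U"
      using \<tau>(2) by (rule image_mono)
    also have "\<dots> \<subseteq> U"
      using elim \<tau>(1) by (intro base_scale assms) (auto simp: abs_le_iff field_simps)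
    finally show ?case .
  qed
qed

text \<open>If the coefficient decreases from \<open>a n\<close> to \<open>b n\<close>, the surplus
  multiple of \<open>S\<close> is dominated by a small multiple of a bounded set. If it increases,
  starshapedness about \<open>y\<close> costs only the translation by
  \<open>(b n - a n) *\<^sub>R y\<close>, which tends to zero. The two sequences themselves need not
  converge.\<close>

lemma asymp_dominated_rescale:
  assumes star: "closedly_starshaped_wrt K S y"
    and bounded: "closedly_lower_bounded \<U> K S"
    and nonneg: "\<And>n. 0 \<le> a n" "\<And>n. 0 \<le> b n"
    and lim: "(\<lambda>n. a n - b n) \<longlonglongrightarrow> 0"
  shows "asymp_dominated (\<lambda>n. a n \<cdot> S) (\<lambda>n. b n \<cdot> S)"
  unfolding asymp_dominated_def
proof
  fix U assume U: "U \<in> \<U>"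
  obtain H where H: "tvs_bounded \<U> H" "S \<preceq> H"
    using bounded by (auto simp: closedly_lower_bounded_def dominated_def)
  have "((\<lambda>n. (a n - b n) *\<^sub>R y) \<longlongrightarrow> 0) sequentially"
    using tendsto_scaleR_tvs[OF lim tendsto_const[of y]] by simp
  then have "\<forall>\<^sub>F n in sequentially. (a n - b n) *\<^sub>R y \<in> U"
    by (rule base_eventually[OF U])
  with bounded_eventually_subset[OF H(1) U lim]
  show "\<forall>\<^sub>F n in sequentially. a n \<cdot> S \<preceq> b n \<cdot> S + U"
  proof eventually_elim
    case (elim n)
    show ?case
    proof (cases "b n \<le> a n")
      case True
      have "a n \<cdot> S \<subseteq> b n \<cdot> S + (a n - b n) \<cdot> S"
        using scale_set_add_subset[of "b n" "a n - b n" S] by simp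
      then have "a n \<cdot> S \<preceq> b n \<cdot> S + (a n - b n) \<cdot> S"
        by (rule subset_dominated)
      also have "\<dots> \<preceq> b n \<cdot> S + (a n - b n) \<cdot> H"
        using True H(2) by (intro dominated_add dominated_refl dominated_scale) auto
      also have "\<dots> \<preceq> b n \<cdot> S + U"
        by (intro subset_dominated set_plus_mono2 order_refl elim)
      finally show ?thesis .
    next
      case False
      with nonneg[of n] have bpos: "b n > 0" "a n / b n \<in> {0..1}"
        by (auto simp: field_simps)
      have "(a n / b n) \<cdot> S + {(1 - a n / b n) *\<^sub>R y} \<preceq> S"
        using star bpos(2) by (auto simp: closedly_starshaped_wrt_def dominated_def)
      then have "b n \<cdot> ((a n / b n) \<cdot> S + {(1 - a n / b n) *\<^sub>R y}) \<preceq> b n \<cdot> S"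
        using nonneg(2) by (rule dominated_scale)
      then have star': "a n \<cdot> S + {(b n - a n) *\<^sub>R y} \<preceq> b n \<cdot> S"
        using bpos(1) by (simp add: scale_set_plus scale_scale_set right_diff_distrib)
      \<comment> \<open>Translating by opposite vectors changes nothing; one translation is used up
        by starshapedness and the other goes into \<open>U\<close>.\<close>
      have "{(b n - a n) *\<^sub>R y} + {(a n - b n) *\<^sub>R y} = 0"
        by (simp add: set_plus_def set_zero flip: scaleR_add_left)
      then have "a n \<cdot> S = (a n \<cdot> S + {(b n - a n) *\<^sub>R y}) + {(a n - b n) *\<^sub>R y}"
        by (simp add: add.assoc)
      also have "\<dots> \<preceq> b n \<cdot> S + U"
        using elim by (intro dominated_add star' subset_dominated) auto
      finally show ?thesis .
    qed
  qed
qed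

text \<open>The coefficients of \<open>A k\<close> are split, the two inclusions are multiplied by
  \<open>l\<close> and \<open>1 - l\<close> and added, and the coefficients of \<open>P\<close>,
  \<open>Q\<close> and \<open>B k\<close> are merged by convexity. The dyadic induction uses
  \<open>l = 1/2\<close>; interpolation inside a cell uses general \<open>l\<close>.\<close>

lemma dominated_convex_combination:
  assumes l: "0 \<le> l" "l \<le> 1"
    and s: "s \<in> {0..1}" "r \<in> {0..1}"
    and nonneg: "\<And>k. k \<in> I \<Longrightarrow> 0 \<le> c k" "\<And>k. k \<in> I \<Longrightarrow> 0 \<le> d k"
    and convex: "closedly_convex K P" "closedly_convex K Q" "\<And>k. k \<in> I \<Longrightarrow> closedly_convex K (B k)"
    and X: "X + (\<Sum>k\<in>I. c k \<cdot> A k) \<preceq> s \<cdot> P + (1 - s) \<cdot> Q + (\<Sum>k\<in>I. c k \<cdot> B k)"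
    and Y: "Y + (\<Sum>k\<in>I. d k \<cdot> A k) \<preceq> r \<cdot> P + (1 - r) \<cdot> Q + (\<Sum>k\<in>I. d k \<cdot> B k)"
  shows "l \<cdot> X + (1 - l) \<cdot> Y + (\<Sum>k\<in>I. (l * c k + (1 - l) * d k) \<cdot> A k) \<preceq>
    (l * s + (1 - l) * r) \<cdot> P + (1 - (l * s + (1 - l) * r)) \<cdot> Q +
    (\<Sum>k\<in>I. (l * c k + (1 - l) * d k) \<cdot> B k)"
proof -
  have "(\<Sum>k\<in>I. (l * c k + (1 - l) * d k) \<cdot> A k) \<subseteq>
      (\<Sum>k\<in>I. (l * c k) \<cdot> A k + ((1 - l) * d k) \<cdot> A k)"
    by (intro set_sum_mono scale_set_add_subset)
  then have "l \<cdot> X + (1 - l) \<cdot> Y + (\<Sum>k\<in>I. (l * c k + (1 - l) * d k) \<cdot> A k) \<preceq>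
      l \<cdot> X + (1 - l) \<cdot> Y + (\<Sum>k\<in>I. (l * c k) \<cdot> A k + ((1 - l) * d k) \<cdot> A k)"
    by (intro dominated_add dominated_refl subset_dominated)
  also have "\<dots> = l \<cdot> (X + (\<Sum>k\<in>I. c k \<cdot> A k)) + (1 - l) \<cdot> (Y + (\<Sum>k\<in>I. d k \<cdot> A k))"
    by (simp only: scale_set_plus scale_set_sum scale_scale_set sum.distrib ac_simps)
  also have "\<dots> \<preceq> l \<cdot> (s \<cdot> P + (1 - s) \<cdot> Q + (\<Sum>k\<in>I. c k \<cdot> B k)) +
      (1 - l) \<cdot> (r \<cdot> P + (1 - r) \<cdot> Q + (\<Sum>k\<in>I. d k \<cdot> B k))"
    using l by (intro dominated_add dominated_scale X Y) auto
  also have "\<dots> = ((l * s) \<cdot> P + ((1 - l) * r) \<cdot> P) +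
      ((l * (1 - s)) \<cdot> Q + ((1 - l) * (1 - r)) \<cdot> Q) +
      (\<Sum>k\<in>I. (l * c k) \<cdot> B k + ((1 - l) * d k) \<cdot> B k)"
    by (simp only: scale_set_plus scale_set_sum scale_scale_set sum.distrib add.assoc add.left_commute)
  also have "\<dots> \<preceq> (l * s + (1 - l) * r) \<cdot> P + (l * (1 - s) + (1 - l) * (1 - r)) \<cdot> Q +
      (\<Sum>k\<in>I. (l * c k + (1 - l) * d k) \<cdot> B k)"
    using l s nonneg by (intro dominated_add dominated_sum convex_dominated convex) auto
  also have "l * (1 - s) + (1 - l) * (1 - r) = 1 - (l * s + (1 - l) * r)"
    by (simp add: algebra_simps)
  finally show ?thesis .
qed

end

section \<open>The weights of the Tabor transformation\<close>

lemma dist_int_le: "dist_int t \<le> \<bar>of_int j - t\<bar>"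
  unfolding dist_int_def by (intro cINF_lower bdd_belowI[of _ 0]) auto

text \<open>Distinct integers are at least 1 apart, so no integer is nearer to \<open>t\<close> than
  one within distance \<open>1/2\<close>.\<close>

lemma dist_int_eq:
  assumes "\<bar>of_int j - t\<bar> \<le> 1 / 2"
  shows "dist_int t = \<bar>of_int j - t\<bar>"
proof (rule antisym[OF dist_int_le])
  have "\<bar>of_int j - t\<bar> \<le> \<bar>of_int i - t\<bar>" for i
  proof (cases "i = j")
    case False
    then have "\<bar>of_int i - of_int j\<bar> \<ge> (1::real)"
      by (metis of_int_1_le_iff of_int_abs of_int_diff int_one_le_iff_zero_less zero_less_abs_iff
          right_minus_eq)
    with assms show ?thesis by linarith
  qed simp
  then show "\<bar>of_int j - t\<bar> \<le> dist_int t"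
    unfolding dist_int_def by (intro cINF_greatest) auto
qed

lemma dist_int_round: "dist_int t = \<bar>of_int (round t) - t\<bar>"
  by (intro dist_int_eq of_int_round_abs_le)

lemma dist_int_nonneg: "0 \<le> dist_int t"
  by (simp add: dist_int_round)

lemma dist_int_le_half: "dist_int t \<le> 1 / 2"
  unfolding dist_int_round by (rule of_int_round_abs_le)

lemma dist_int_of_int: "dist_int (of_int j) = 0"
  using dist_int_eq[of j "of_int j"] by simp

lemma dist_int_half: "dist_int (of_int j + 1 / 2) = 1 / 2"
  using dist_int_eq[of j "of_int j + 1 / 2"] by simp

lemma dist_int_add_int: "dist_int (of_int j + t) = dist_int t"
  using dist_int_eq[of "j + round t" "of_int j + t"] of_int_round_abs_le[of t]
  by (simp add: dist_int_round[of t])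

lemma dist_int_lipschitz: "\<bar>dist_int s - dist_int t\<bar> \<le> \<bar>s - t\<bar>"
proof -
  have "dist_int s \<le> \<bar>s - t\<bar> + dist_int t" for s t
    using dist_int_le[of s "round t"] unfolding dist_int_round[of t] by linarith
  from this[of s t] this[of t s] show ?thesis by linarith
qed

text \<open>Between consecutive multiples of \<open>1/2\<close> the nearest integer is the left end
  for even \<open>i\<close> and the right end for odd \<open>i\<close>.\<close>

lemma dist_int_cell:
  assumes "of_int i / 2 \<le> t" "t \<le> of_int (i + 1) / 2"
  shows "dist_int t = (if even i then t - of_int i / 2 else of_int (i + 1) / 2 - t)"
proof (cases "even i")
  case True
  then obtain j where "i = 2 * j" by blast
  with assms show ?thesis by (subst dist_int_eq[of j]) (auto simp: abs_if)
next
  case False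
  then obtain j where "i = 2 * j + 1" by (auto elim: oddE)
  with assms show ?thesis by (subst dist_int_eq[of "j + 1"]) (auto simp: abs_if)
qed

lemma dist_int_affine_on_cell:
  assumes "of_int i / 2 \<le> s" "s \<le> of_int (i + 1) / 2"
    and "of_int i / 2 \<le> r" "r \<le> of_int (i + 1) / 2"
    and "0 \<le> l" "l \<le> 1"
  shows "dist_int (l * s + (1 - l) * r) = l * dist_int s + (1 - l) * dist_int r"
proof -
  have "l * s + (1 - l) * r \<in> {of_int i / 2..of_int (i + 1) / 2}"
    using convexD[OF convex_real_interval(5), of s "of_int i / 2" "of_int (i + 1) / 2" r l "1 - l"]
      assms by auto
  then show ?thesis
    using assms by (auto simp: dist_int_cell algebra_simps)
qed

text \<open>The factor 2 gives values in \<open>[0, 1]\<close>, the range in which starshapedness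
  compares a multiple of a set with the set itself.\<close>

definition tabor_weight :: "nat \<Rightarrow> real \<Rightarrow> real" where
  "tabor_weight k t = 2 * dist_int (2 ^ k * t)"

lemma tabor_weight_nonneg: "0 \<le> tabor_weight k t"
  by (simp add: tabor_weight_def dist_int_nonneg)

lemma tabor_weight_le_one: "tabor_weight k t \<le> 1"
  using dist_int_le_half[of "2 ^ k * t"] by (simp add: tabor_weight_def)

lemma tabor_weight_dyadic: "tabor_weight n (real i / 2 ^ n) = 0"
  using dist_int_of_int[of "int i"] by (simp add: tabor_weight_def)

lemma tabor_weight_odd_dyadic: "tabor_weight n (real (2 * i + 1) / 2 ^ Suc n) = 1"
proof -
  have "2 ^ n * (real (2 * i + 1) / 2 ^ Suc n) = of_int (int i) + 1 / 2"
    by (simp add: field_simps)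
  then show ?thesis unfolding tabor_weight_def by (simp only: dist_int_half)
qed

text \<open>The weights are self-similar: magnifying a cell of level \<open>m\<close> lowers the
  index by \<open>m\<close>, because \<open>dist_int\<close> has period 1.\<close>

lemma tabor_weight_shift:
  "tabor_weight (m + k) (real j / 2 ^ m + t / 2 ^ m) = tabor_weight k t"
proof -
  have "2 ^ (m + k) * (real j / 2 ^ m + t / 2 ^ m) = of_int (2 ^ k * int j) + 2 ^ k * t"
    by (simp add: power_add field_simps)
  then show ?thesis unfolding tabor_weight_def by (simp only: dist_int_add_int)
qed

lemma tabor_weight_tendsto:
  assumes "(s \<longlongrightarrow> t) G"
  shows "((\<lambda>i. tabor_weight k (s i)) \<longlongrightarrow> tabor_weight k t) G"
proof -
  have "((\<lambda>i. 2 ^ k * s i - 2 ^ k * t) \<longlongrightarrow> 2 ^ k * t - 2 ^ k * t) G"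
    by (intro tendsto_intros assms)
  then have "((\<lambda>i. dist_int (2 ^ k * s i)) \<longlongrightarrow> dist_int (2 ^ k * t)) G"
    by (subst LIM_zero_iff[symmetric]) (rule Lim_null_comparison[rotated, OF tendsto_rabs_zero],
      auto intro!: always_eventually dist_int_lipschitz)
  then show ?thesis unfolding tabor_weight_def by (rule tendsto_mult_left)
qed

text \<open>Multiplication by \<open>2 ^ k\<close> carries a cell of level \<open>m > k\<close> into
  an interval between consecutive multiples of \<open>1/2\<close>, on which \<open>dist_int\<close>
  is affine.\<close>

lemma tabor_weight_affine_on_cell:
  assumes k: "k < m" and l: "0 \<le> l" "l \<le> 1"
  shows "tabor_weight k (l * (real (i + 1) / 2 ^ m) + (1 - l) * (real i / 2 ^ m)) =
    l * tabor_weight k (real (i + 1) / 2 ^ m) + (1 - l) * tabor_weight k (real i / 2 ^ m)"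
proof -
  obtain p where m: "m = Suc (k + p)"
    using less_imp_Suc_add[OF k] by blast
  define q :: nat where "q = 2 ^ p"
  have q: "q > 0" by (simp add: q_def)
  have eq: "2 ^ k * (x / 2 ^ m) = x / q / 2" for x :: real
    by (simp add: q_def m power_add)
  \<comment> \<open>The image of the cell has ends \<open>i / q / 2\<close> and
    \<open>(i + 1) / q / 2\<close>. As \<open>i\<close> is an integer, \<open>i + 1\<close> does not
    exceed the next multiple of \<open>q\<close>, so the image does not cross
    \<open>(j + 1) / 2\<close>.\<close>
  define j where "j = int (i div q)"
  have "q * (i div q) \<le> i" "i + 1 \<le> q * (i div q + 1)"
    using q dividend_less_times_div[of q i] by (auto simp: Suc_le_eq)
  then have "real q * real (i div q) \<le> real i" "real (i + 1) \<le> real q * real (i div q + 1)"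
    by (metis of_nat_le_iff of_nat_mult)+
  then have "of_int j / 2 \<le> real i / q / 2" "real (i + 1) / q / 2 \<le> of_int (j + 1) / 2"
    "real i / q / 2 \<le> real (i + 1) / q / 2"
    using q by (auto simp: j_def field_simps)
  then have "dist_int (l * (real (i + 1) / q / 2) + (1 - l) * (real i / q / 2)) =
      l * dist_int (real (i + 1) / q / 2) + (1 - l) * dist_int (real i / q / 2)"
    using l by (intro dist_int_affine_on_cell[of j]) linarith+
  moreover have "2 ^ k * (l * (real (i + 1) / 2 ^ m) + (1 - l) * (real i / 2 ^ m)) =
      l * (2 ^ k * (real (i + 1) / 2 ^ m)) + (1 - l) * (2 ^ k * (real i / 2 ^ m))"
    by (simp add: algebra_simps)
  ultimately show ?thesis
    unfolding tabor_weight_def eq by simp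
qed

section \<open>Set-valued maps satisfying a Jensen inclusion\<close>

lemma self_difference_scale:
  assumes "convex D" "u \<in> self_difference D" "0 \<le> c" "c \<le> 1"
  shows "c *\<^sub>R u \<in> self_difference D"
proof -
  obtain a b where ab: "u = a - b" "a \<in> D" "b \<in> D"
    using assms(2) by (auto simp: self_difference_def)
  have "c *\<^sub>R u = (c *\<^sub>R a + (1 - c) *\<^sub>R b) - b"
    by (simp add: ab algebra_simps)
  moreover have "c *\<^sub>R a + (1 - c) *\<^sub>R b \<in> D"
    using assms ab by (intro convexD) auto
  ultimately show ?thesis
    using ab(3) unfolding self_difference_def by blast
qed

lemma sum_lessThan_add:
  fixes f :: "nat \<Rightarrow> 'b::comm_monoid_add"
  shows "(\<Sum>k<m + n. f k) = (\<Sum>k<m. f k) + (\<Sum>k<n. f (m + k))"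
  by (induction n) (simp_all add: add.assoc)

definition segment_point :: "'a::real_vector \<Rightarrow> 'a \<Rightarrow> real \<Rightarrow> 'a" where
  "segment_point x y t = t *\<^sub>R x + (1 - t) *\<^sub>R y"

lemma segment_point_convex_combination:
  "segment_point (segment_point x y s) (segment_point x y r) l =
    segment_point x y (l * s + (1 - l) * r)"
  by (simp add: segment_point_def algebra_simps)

lemma segment_point_diff:
  "segment_point x y s - segment_point x y r = (s - r) *\<^sub>R (x - y)"
  by (simp add: segment_point_def algebra_simps)

lemma segment_point_mem:
  "convex D \<Longrightarrow> x \<in> D \<Longrightarrow> y \<in> D \<Longrightarrow> 0 \<le> t \<Longrightarrow> t \<le> 1 \<Longrightarrow> segment_point x y t \<in> D"
  unfolding segment_point_def by (intro convexD) auto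

text \<open>Here \<open>K\<close> is any convex cone containing zero; the closed recession cone is
  inserted at the end.\<close>

locale jensen_map = tvs_cone \<U> K
  for \<U> :: "'b::hausdorff_tvs set set" and K :: "'b set" +
  fixes D :: "'a::real_vector set" and A B F :: "'a \<Rightarrow> 'b set"
  assumes convex_D: "convex D"
    and A_nonempty: "\<And>u. u \<in> self_difference D \<Longrightarrow> A u \<noteq> {}"
    and B_nonempty: "\<And>u. u \<in> self_difference D \<Longrightarrow> B u \<noteq> {}"
    and F_nonempty: "\<And>x. x \<in> D \<Longrightarrow> F x \<noteq> {}"
    and jensen: "\<And>x y. x \<in> D \<Longrightarrow> y \<in> D \<Longrightarrow>
      F ((x + y) /\<^sub>R 2) + A (x - y) \<subseteq> closure ((1/2) \<cdot> (F x + F y) + B (x - y))"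
    and F_convex: "\<And>x. x \<in> D \<Longrightarrow> closedly_convex K (F x)"
    and F_starshaped: "\<And>x. x \<in> D \<Longrightarrow> \<exists>y. closedly_starshaped_wrt K (F x) y"
    and F_bounded: "\<And>x. x \<in> D \<Longrightarrow> closedly_lower_bounded \<U> K (F x)"
    and F_usc: "\<And>p. p \<in> D \<Longrightarrow> directionally_usc_at \<U> K D F p"
    and A_starshaped: "\<And>u. u \<in> self_difference D \<Longrightarrow> closedly_starshaped K (A u)"
    and A_bounded: "\<And>u. u \<in> self_difference D \<Longrightarrow> closedly_lower_bounded \<U> K (A u)"
    and B_starshaped: "\<And>u. u \<in> self_difference D \<Longrightarrow> closedly_starshaped K (B u)"
    and B_bounded: "\<And>u. u \<in> self_difference D \<Longrightarrow> closedly_lower_bounded \<U> K (B u)"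
    and B_convex: "\<And>u. u \<in> self_difference D \<Longrightarrow> closedly_convex K (B u)"
    and B_Cauchy: "\<And>u. u \<in> self_difference D \<Longrightarrow> serially_Cauchy \<U> K (\<lambda>k. B (u /\<^sub>R 2 ^ k))"
begin

section \<open>The inclusion at dyadic parameters\<close>

lemma diff_mem: "x \<in> D \<Longrightarrow> y \<in> D \<Longrightarrow> (x - y) /\<^sub>R 2 ^ k \<in> self_difference D"
  by (rule self_difference_scale[OF convex_D])
    (auto simp: self_difference_def inverse_le_1_iff)

lemma jensen_dominated:
  assumes "x \<in> D" "y \<in> D"
  shows "F (segment_point x y (1 / 2)) + A (x - y) \<preceq> (1/2) \<cdot> F x + (1/2) \<cdot> F y + B (x - y)"
proof -
  have "segment_point x y (1 / 2) = (x + y) /\<^sub>R 2"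
    by (simp add: segment_point_def scaleR_add_right)
  moreover have "closure S \<subseteq> closure (S + K)" for S
    by (intro closure_mono subset_set_plus_left zero_mem)
  ultimately show ?thesis
    using jensen[OF assms] unfolding dominated_def scale_set_plus by fastforce
qed

lemma jensen_dyadic:
  assumes x: "x \<in> D" and y: "y \<in> D" and i: "i \<le> 2 ^ n"
  shows "F (segment_point x y (real i / 2 ^ n)) +
      (\<Sum>k<n. tabor_weight k (real i / 2 ^ n) \<cdot> A ((x - y) /\<^sub>R 2 ^ k)) \<preceq>
    (real i / 2 ^ n) \<cdot> F x + (1 - real i / 2 ^ n) \<cdot> F y +
      (\<Sum>k<n. tabor_weight k (real i / 2 ^ n) \<cdot> B ((x - y) /\<^sub>R 2 ^ k))"
  using i
proof (induction n arbitrary: i)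
  case 0
  then consider "i = 0" | "i = 1" by fastforce
  then show ?case
  proof cases
    case 1
    then show ?thesis
      using zero_scale_set[OF F_nonempty[OF x]]
      by (simp add: segment_point_def dominated_refl)
  next
    case 2
    then show ?thesis
      using zero_scale_set[OF F_nonempty[OF y]]
      by (simp add: segment_point_def dominated_refl)
  qed
next
  case (Suc n)
  show ?case
  proof (cases "even i")
    case True
    \<comment> \<open>The fraction reduces to level \<open>n\<close>, and the summand of index
      \<open>n\<close> has weight zero, so it is \<open>{0}\<close>.\<close>
    then obtain j where j: "i = 2 * j" by blast
    have t: "real i / 2 ^ Suc n = real j / 2 ^ n" by (simp add: j)
    have "j \<le> 2 ^ n" using Suc.prems j by simp
    from Suc.IH[OF this] show ?thesis
      unfolding t sum.lessThan_Suc tabor_weight_dyadic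
      using zero_scale_set[OF A_nonempty] zero_scale_set[OF B_nonempty] diff_mem[OF x y, of n]
      by simp
  next
    case False
    then obtain j where j: "i = 2 * j + 1" by (auto elim: oddE)
    \<comment> \<open>\<open>s\<close> and \<open>r\<close> are the neighbours of \<open>t\<close>
      on the grid of level \<open>n\<close>. Their distance \<open>1 / 2 ^ n\<close> turns the
      Jensen terms at the midpoint into the summands of index \<open>n\<close>.\<close>
    define s r t where "s = real (j + 1) / 2 ^ n" and "r = real j / 2 ^ n"
      and "t = real i / 2 ^ Suc n"
    have bound: "j + 1 \<le> 2 ^ n" using Suc.prems j by simp
    then have "real (j + 1) \<le> 2 ^ n" by (metis of_nat_le_iff of_nat_numeral of_nat_power)
    then have sr: "s \<in> {0..1}" "r \<in> {0..1}" using bound by (auto simp: s_def r_def)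
    have t: "t = 1/2 * s + (1 - 1/2) * r"
      by (simp add: s_def r_def t_def j field_simps)
    have weights: "tabor_weight k t = 1/2 * tabor_weight k s + (1 - 1/2) * tabor_weight k r"
      if "k \<in> {..<n}" for k
      unfolding t s_def r_def using that by (intro tabor_weight_affine_on_cell) auto
    have weight_n: "tabor_weight n t = 1"
      unfolding t_def j by (rule tabor_weight_odd_dyadic)
    let ?X = "F (segment_point x y s)" and ?Y = "F (segment_point x y r)"
    have mem: "segment_point x y s \<in> D" "segment_point x y r \<in> D"
      using sr by (auto intro!: segment_point_mem convex_D x y)
    have "s - r = inverse (2 ^ n)" by (simp add: s_def r_def field_simps)
    then have step: "F (segment_point x y t) + A ((x - y) /\<^sub>R 2 ^ n) \<preceq>
        (1/2) \<cdot> ?X + (1 - 1/2) \<cdot> ?Y + B ((x - y) /\<^sub>R 2 ^ n)"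
      using jensen_dominated[OF mem]
      by (simp add: segment_point_convex_combination segment_point_diff t)
    \<comment> \<open>The induction hypotheses at \<open>s\<close> and \<open>r\<close> are
      averaged. The coefficient stays in the form \<open>1 - 1/2\<close> to fit
      \<open>dominated_convex_combination\<close>.\<close>
    have "(1/2) \<cdot> ?X + (1 - 1/2) \<cdot> ?Y +
        (\<Sum>k<n. (1/2 * tabor_weight k s + (1 - 1/2) * tabor_weight k r) \<cdot> A ((x - y) /\<^sub>R 2 ^ k)) \<preceq>
        (1/2 * s + (1 - 1/2) * r) \<cdot> F x + (1 - (1/2 * s + (1 - 1/2) * r)) \<cdot> F y +
        (\<Sum>k<n. (1/2 * tabor_weight k s + (1 - 1/2) * tabor_weight k r) \<cdot> B ((x - y) /\<^sub>R 2 ^ k))"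
      using bound sr unfolding s_def r_def
      by (intro dominated_convex_combination Suc.IH F_convex B_convex x y diff_mem
          tabor_weight_nonneg) auto
    then have lower: "(1/2) \<cdot> ?X + (1 - 1/2) \<cdot> ?Y +
        (\<Sum>k<n. tabor_weight k t \<cdot> A ((x - y) /\<^sub>R 2 ^ k)) \<preceq>
        t \<cdot> F x + (1 - t) \<cdot> F y + (\<Sum>k<n. tabor_weight k t \<cdot> B ((x - y) /\<^sub>R 2 ^ k))"
      unfolding t[symmetric] by (simp only: weights cong: sum.cong)
    have "F (segment_point x y t) + (\<Sum>k<Suc n. tabor_weight k t \<cdot> A ((x - y) /\<^sub>R 2 ^ k)) =
        (F (segment_point x y t) + A ((x - y) /\<^sub>R 2 ^ n)) +
        (\<Sum>k<n. tabor_weight k t \<cdot> A ((x - y) /\<^sub>R 2 ^ k))"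
      by (simp add: weight_n ac_simps)
    also have "\<dots> \<preceq> ((1/2) \<cdot> ?X + (1 - 1/2) \<cdot> ?Y + B ((x - y) /\<^sub>R 2 ^ n)) +
        (\<Sum>k<n. tabor_weight k t \<cdot> A ((x - y) /\<^sub>R 2 ^ k))"
      by (intro dominated_add dominated_refl step)
    also have "\<dots> = ((1/2) \<cdot> ?X + (1 - 1/2) \<cdot> ?Y +
        (\<Sum>k<n. tabor_weight k t \<cdot> A ((x - y) /\<^sub>R 2 ^ k))) + B ((x - y) /\<^sub>R 2 ^ n)"
      by (simp only: ac_simps)
    also have "\<dots> \<preceq> (t \<cdot> F x + (1 - t) \<cdot> F y +
        (\<Sum>k<n. tabor_weight k t \<cdot> B ((x - y) /\<^sub>R 2 ^ k))) + B ((x - y) /\<^sub>R 2 ^ n)"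
      by (intro dominated_add dominated_refl lower)
    also have "\<dots> = t \<cdot> F x + (1 - t) \<cdot> F y +
        (\<Sum>k<Suc n. tabor_weight k t \<cdot> B ((x - y) /\<^sub>R 2 ^ k))"
      by (simp add: weight_n ac_simps)
    finally show ?thesis unfolding t_def .
  qed
qed

section \<open>Limits along sequences of parameters\<close>

lemma usc_asymp_dominated:
  assumes p: "p \<in> D" and d: "\<And>n. 0 \<le> d n" "d \<longlonglongrightarrow> 0"
    and mem: "\<forall>\<^sub>F n in sequentially. p + d n *\<^sub>R h \<in> D"
  shows "asymp_dominated (\<lambda>n. F (p + d n *\<^sub>R h)) (\<lambda>n. F p)"
  unfolding asymp_dominated_def
proof
  fix U assume U: "U \<in> \<U>"
  then obtain \<delta> where \<delta>: "\<delta> > 0"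
    "\<And>t. 0 < t \<Longrightarrow> t < \<delta> \<Longrightarrow> p + t *\<^sub>R h \<in> D \<Longrightarrow> F (p + t *\<^sub>R h) \<subseteq> F p + U + K"
    using F_usc[OF p] unfolding directionally_usc_at_def by meson
  have "\<forall>\<^sub>F n in sequentially. d n < \<delta>"
    using order_tendstoD(2)[OF d(2) \<delta>(1)] .
  with mem show "\<forall>\<^sub>F n in sequentially. F (p + d n *\<^sub>R h) \<preceq> F p + U"
  proof eventually_elim
    case (elim n)
    show ?case
    \<comment> \<open>The semicontinuity condition speaks of positive parameters only, whereas a
      shift may be zero.\<close>
    proof (cases "d n = 0")
      case True
      then show ?thesis
        using base_zero[OF U] by (simp add: subset_dominated subset_set_plus_left)
    next
      case False
      then show ?thesis
        using \<delta>(2)[of "d n"] d(1)[of n] elim by (intro subset_plus_K_dominated) auto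
    qed
  qed
qed

text \<open>Both the weights and the number of terms change with \<open>n\<close>. Below the Cauchy
  index \<open>N\<close> there are finitely many terms, each handled by rescaling. From
  \<open>N\<close> on, starshapedness replaces all weights by 1, and the Cauchy condition bounds the
  sum independently of them.\<close>

lemma tabor_sum_asymp_dominated:
  assumes u: "\<And>k. u /\<^sub>R 2 ^ k \<in> self_difference D" and s: "s \<longlonglongrightarrow> t"
  shows "asymp_dominated (\<lambda>n. \<Sum>k<m + n. tabor_weight k (s n) \<cdot> B (u /\<^sub>R 2 ^ k))
    (\<lambda>n. tabor_transform B t u)"
  unfolding asymp_dominated_def
proof
  fix U assume "U \<in> \<U>"
  then obtain V where V: "V \<in> \<U>" "V + V \<subseteq> U" by (rule base_split)
  have "serially_Cauchy \<U> K (\<lambda>k. B (u /\<^sub>R 2 ^ k))"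
    using B_Cauchy[of u] u[of 0] by simp
  then obtain N where N: "\<And>n. n \<ge> N \<Longrightarrow> (\<Sum>k=N..n. B (u /\<^sub>R 2 ^ k)) \<subseteq> V + K"
    using V(1) unfolding serially_Cauchy_def by meson
  have star: "0 \<preceq> tabor_weight k r \<cdot> B (u /\<^sub>R 2 ^ k)" for k r
    by (intro starshaped_zero_dominated B_starshaped B_nonempty u tabor_weight_nonneg)
  have "asymp_dominated (\<lambda>n. \<Sum>k<N. tabor_weight k (s n) \<cdot> B (u /\<^sub>R 2 ^ k))
      (\<lambda>n. \<Sum>k<N. tabor_weight k t \<cdot> B (u /\<^sub>R 2 ^ k))"
    using B_starshaped[OF u] unfolding closedly_starshaped_def
    by (intro asymp_dominated_sum asymp_dominated_rescale B_bounded u tabor_weight_nonneg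
        LIM_zero tabor_weight_tendsto s)
  then have close: "\<forall>\<^sub>F n in sequentially. (\<Sum>k<N. tabor_weight k (s n) \<cdot> B (u /\<^sub>R 2 ^ k)) \<preceq>
      (\<Sum>k<N. tabor_weight k t \<cdot> B (u /\<^sub>R 2 ^ k)) + V"
    using V(1) by (simp add: asymp_dominated_def)
  \<comment> \<open>The partial sums in the transform include the index \<open>N\<close>; the
    additional term dominates \<open>0\<close>.\<close>
  have head: "(\<Sum>k<N. tabor_weight k t \<cdot> B (u /\<^sub>R 2 ^ k)) \<preceq> tabor_transform B t u"
  proof -
    have "(\<Sum>k<N. tabor_weight k t \<cdot> B (u /\<^sub>R 2 ^ k)) \<preceq>
        (\<Sum>k=0..N. tabor_weight k t \<cdot> B (u /\<^sub>R 2 ^ k))"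
      by (intro dominated_sum_superset star) auto
    also have "\<dots> \<preceq> tabor_transform B t u"
      unfolding tabor_transform_def tabor_weight_def
      by (intro subset_dominated order_trans[OF _ closure_subset]) blast
    finally show ?thesis .
  qed
  show "\<forall>\<^sub>F n in sequentially. (\<Sum>k<m + n. tabor_weight k (s n) \<cdot> B (u /\<^sub>R 2 ^ k)) \<preceq>
      tabor_transform B t u + U"
    using close eventually_gt_at_top[of N]
  proof eventually_elim
    case (elim n)
    \<comment> \<open>The Cauchy condition includes the last index of the sum, and
      \<open>n > N\<close> ensures \<open>N \<le> M\<close>.\<close>
    define M where "M = m + n - 1"
    have M: "m + n = Suc M" "N \<le> M" using elim(2) by (auto simp: M_def)
    have "{..<m + n} = {..<N} \<union> {N..M}" "{..<N} \<inter> {N..M} = {}" using M by auto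
    then have "(\<Sum>k<m + n. tabor_weight k (s n) \<cdot> B (u /\<^sub>R 2 ^ k)) =
        (\<Sum>k<N. tabor_weight k (s n) \<cdot> B (u /\<^sub>R 2 ^ k)) +
        (\<Sum>k=N..M. tabor_weight k (s n) \<cdot> B (u /\<^sub>R 2 ^ k))"
      by (simp add: sum.union_disjoint)
    also have "\<dots> \<preceq> ((\<Sum>k<N. tabor_weight k t \<cdot> B (u /\<^sub>R 2 ^ k)) + V) +
        (\<Sum>k=N..M. B (u /\<^sub>R 2 ^ k))"
      by (intro dominated_add elim dominated_sum starshaped_dominated B_starshaped u
          tabor_weight_nonneg tabor_weight_le_one)
    also have "\<dots> \<preceq> (tabor_transform B t u + V) + V"
      by (intro dominated_add head dominated_refl subset_plus_K_dominated N M)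
    also have "\<dots> \<preceq> tabor_transform B t u + U"
      unfolding add.assoc by (intro subset_dominated set_plus_mono2 order_refl V)
    finally show ?case .
  qed
qed

text \<open>With \<open>N\<close> fixed, the weights move from \<open>t\<close> to
  \<open>s n\<close> by rescaling finitely many terms. The terms missing up to \<open>m + n\<close>
  may be added because each dominates \<open>0\<close>.\<close>

lemma partial_sum_asymp_dominated:
  assumes u: "\<And>k. u /\<^sub>R 2 ^ k \<in> self_difference D" and s: "s \<longlonglongrightarrow> t"
  shows "asymp_dominated (\<lambda>n. \<Sum>k=0..N. tabor_weight k t \<cdot> A (u /\<^sub>R 2 ^ k))
    (\<lambda>n. \<Sum>k<m + n. tabor_weight k (s n) \<cdot> A (u /\<^sub>R 2 ^ k))"
proof -
  have "(\<lambda>n. tabor_weight k t - tabor_weight k (s n)) \<longlonglongrightarrow> tabor_weight k t - tabor_weight k t" for k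
    by (intro tendsto_intros tabor_weight_tendsto s)
  then have "asymp_dominated (\<lambda>n. \<Sum>k=0..N. tabor_weight k t \<cdot> A (u /\<^sub>R 2 ^ k))
      (\<lambda>n. \<Sum>k=0..N. tabor_weight k (s n) \<cdot> A (u /\<^sub>R 2 ^ k))"
    using A_starshaped[OF u] unfolding closedly_starshaped_def
    by (intro asymp_dominated_sum asymp_dominated_rescale A_bounded u tabor_weight_nonneg) simp_all
  also have "asymp_dominated \<dots> (\<lambda>n. \<Sum>k<m + n. tabor_weight k (s n) \<cdot> A (u /\<^sub>R 2 ^ k))"
  proof (rule asymp_dominatedI)
    show "\<forall>\<^sub>F n in sequentially. (\<Sum>k=0..N. tabor_weight k (s n) \<cdot> A (u /\<^sub>R 2 ^ k)) \<preceq>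
        (\<Sum>k<m + n. tabor_weight k (s n) \<cdot> A (u /\<^sub>R 2 ^ k))"
      using eventually_gt_at_top[of N]
    proof eventually_elim
      case (elim n)
      then show ?case
        by (intro dominated_sum_superset starshaped_zero_dominated A_starshaped A_nonempty u
            tabor_weight_nonneg) auto
    qed
  qed
  finally show ?thesis .
qed

text \<open>\<open>F\<close> is evaluated at \<open>t\<close> itself, while coefficients and weights
  belong to \<open>s n\<close>. Afterwards only these real numbers have to converge.\<close>

lemma jensen_shifted_dyadic:
  assumes x: "x \<in> D" and y: "y \<in> D" and t: "0 \<le> t" "t < 1"
  obtains m and s where "s \<longlonglongrightarrow> t" "\<And>n. s n \<in> {0..1}"
    "asymp_dominated
      (\<lambda>n. F (segment_point x y t) + (\<Sum>k<m + n. tabor_weight k (s n) \<cdot> A ((x - y) /\<^sub>R 2 ^ k)))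
      (\<lambda>n. s n \<cdot> F x + (1 - s n) \<cdot> F y + (\<Sum>k<m + n. tabor_weight k (s n) \<cdot> B ((x - y) /\<^sub>R 2 ^ k)))"
proof -
  \<comment> \<open>A cell shorter than \<open>1 - t\<close> that contains \<open>t\<close> ends
    below 1, which leaves room for the shift.\<close>
  obtain m where m: "(1 / 2) ^ m < 1 - t"
    using real_arch_pow_inv[of "1 - t" "1 / 2"] t by auto
  define j where "j = nat \<lfloor>2 ^ m * t\<rfloor>"
  \<comment> \<open>This is the position of \<open>t\<close> in its cell, rescaled to run from 0 to
    1.\<close>
  define \<tau> where "\<tau> = 2 ^ m * t - real j"
  have j: "real j = of_int \<lfloor>2 ^ m * t\<rfloor>" using t by (simp add: j_def)
  have \<tau>: "0 \<le> \<tau>" "\<tau> < 1" unfolding \<tau>_def j by linarith+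
  define s0 s1 where "s0 = real j / 2 ^ m" and "s1 = real (j + 1) / 2 ^ m"
  have t_eq: "t = s0 + \<tau> / 2 ^ m" by (simp add: s0_def \<tau>_def field_simps)
  have s1_eq: "s1 = s0 + 1 / 2 ^ m" by (simp add: s0_def s1_def field_simps)
  have s0: "0 \<le> s0" by (simp add: s0_def)
  have "\<tau> / 2 ^ m \<ge> 0" "1 / 2 ^ m > (0::real)" using \<tau> by auto
  then have s1: "s1 < 1" "s0 < s1"
    using m t_eq s1_eq by (auto simp: power_one_over)
  then have "real (j + 1) < 2 ^ m" by (simp add: s1_def)
  then have "real (j + 1) < real (2 ^ m)" by simp
  then have j_le: "j + 1 \<le> 2 ^ m" unfolding of_nat_less_iff by simp

  \<comment> \<open>\<open>l n\<close> is the last grid point of level \<open>n\<close> not beyond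
    \<open>\<tau>\<close>, \<open>s n\<close> is the corresponding parameter, and \<open>d n\<close>
    is the shift that carries \<open>s n\<close> to \<open>t\<close>.\<close>
  define r where "r n = nat \<lfloor>2 ^ n * \<tau>\<rfloor>" for n
  define l where "l n = real (r n) / 2 ^ n" for n
  define s where "s n = s0 + l n / 2 ^ m" for n
  define d where "d n = (\<tau> - l n) / 2 ^ m" for n
  have r: "real (r n) = of_int \<lfloor>2 ^ n * \<tau>\<rfloor>" for n using \<tau> by (simp add: r_def)
  have r_le: "real (r n) \<le> 2 ^ n * \<tau>" "2 ^ n * \<tau> < real (r n) + 1" for n
    unfolding r by linarith+
  have l_le: "0 \<le> l n" "l n \<le> \<tau>" "\<tau> - l n \<le> (1 / 2) ^ n" for n
  proof -
    have "\<tau> - l n = (2 ^ n * \<tau> - real (r n)) / 2 ^ n" by (simp add: l_def field_simps)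
    also have "\<dots> \<le> 1 / 2 ^ n" using r_le[of n] by (intro divide_right_mono) auto
    finally show "\<tau> - l n \<le> (1 / 2) ^ n" by (simp add: power_one_over)
  qed (use r_le[of n] in \<open>auto simp: l_def field_simps\<close>)
  have r_bound: "r n \<le> 2 ^ n" for n
  proof -
    have "2 ^ n * \<tau> \<le> 2 ^ n * 1" using \<tau> by (intro mult_left_mono) auto
    then have "real (r n) \<le> 2 ^ n" using r_le(1)[of n] by linarith
    then have "real (r n) \<le> real (2 ^ n)" by simp
    then show ?thesis unfolding of_nat_le_iff .
  qed
  have "(\<lambda>n. \<tau> - l n) \<longlonglongrightarrow> 0"
    by (rule tendsto_sandwich[OF _ _ tendsto_const LIMSEQ_power_zero[of "1 / 2 :: real"]])
      (use l_le in auto)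
  then have d_lim: "d \<longlonglongrightarrow> 0"
    unfolding d_def by (rule tendsto_divide_zero)
  have d_nonneg: "0 \<le> d n" for n using l_le by (simp add: d_def)
  have s_eq: "s n = t - d n" for n
    by (simp add: s_def d_def t_eq diff_divide_distrib)
  have s_conv: "s n = l n * s1 + (1 - l n) * s0" for n
    by (simp add: s_def s1_eq algebra_simps)
  have "(\<lambda>n. t - d n) \<longlonglongrightarrow> t - 0" by (intro tendsto_intros d_lim)
  then have s_lim: "s \<longlonglongrightarrow> t" unfolding s_eq by simp
  have "0 \<le> s n" for n using s0 l_le by (simp add: s_def)
  moreover have "s n \<le> 1" for n using s_eq[of n] d_nonneg[of n] t by simp
  ultimately have s_mem: "s n \<in> {0..1}" for n by simp

  let ?p = "segment_point x y"
  let ?u = "\<lambda>k. (x - y) /\<^sub>R 2 ^ k"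
  have mem: "?p s0 \<in> D" "?p s1 \<in> D"
    using s0 s1 by (auto intro!: segment_point_mem convex_D x y)
  have "\<forall>\<^sub>F n in sequentially. d n < 1 - s1"
    using order_tendstoD(2)[OF d_lim, of "1 - s1"] s1 by simp
  then have shift_mem: "\<forall>\<^sub>F n in sequentially. ?p (s0 + d n) \<in> D \<and> ?p (s1 + d n) \<in> D"
    using s0 s1 d_nonneg
    by (auto elim!: eventually_mono intro!: segment_point_mem convex_D x y add_nonneg_nonneg)
  have shift: "?p (a + d n) = ?p a + d n *\<^sub>R (x - y)" for a n
    by (simp add: segment_point_def algebra_simps)
  have usc: "asymp_dominated (\<lambda>n. F (?p (a + d n))) (\<lambda>n. F (?p a))" if "a = s0 \<or> a = s1" for a
    unfolding shift using that mem shift_mem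
    by (intro usc_asymp_dominated d_nonneg d_lim) (auto simp: shift elim: eventually_mono)

  \<comment> \<open>Position \<open>l n\<close> between the shifted ends is exactly
    \<open>t\<close>. The ends differ by \<open>(x - y) /\<^sub>R 2 ^ m\<close>, so both the
    arguments and, by self-similarity, the weights start at index \<open>m\<close>.\<close>
  have upper: "\<forall>\<^sub>F n in sequentially.
      F (?p t) + (\<Sum>k<n. tabor_weight (m + k) (s n) \<cdot> A (?u (m + k))) \<preceq>
      l n \<cdot> F (?p (s1 + d n)) + (1 - l n) \<cdot> F (?p (s0 + d n)) +
      (\<Sum>k<n. tabor_weight (m + k) (s n) \<cdot> B (?u (m + k)))"
    using shift_mem
  proof eventually_elim
    case (elim n)
    have "l n * (s1 + d n) + (1 - l n) * (s0 + d n) = t"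
      using s_conv[of n] s_eq[of n] by (simp add: algebra_simps)
    then have "segment_point (?p (s1 + d n)) (?p (s0 + d n)) (l n) = ?p t"
      by (simp add: segment_point_convex_combination)
    moreover have "(?p (s1 + d n) - ?p (s0 + d n)) /\<^sub>R 2 ^ k = ?u (m + k)" for k
      by (simp add: segment_point_diff s1_eq power_add field_simps)
    moreover have "tabor_weight (m + k) (s n) = tabor_weight k (l n)" for k
      unfolding s_def s0_def by (rule tabor_weight_shift)
    ultimately show ?case
      using jensen_dyadic[of "?p (s1 + d n)" "?p (s0 + d n)" "r n" n] elim r_bound[of n]
      by (simp add: l_def[symmetric])
  qed

  \<comment> \<open>This supplies the indices below \<open>m\<close>: their weights are affine on
    the cell, so the dyadic inclusions at its ends combine to one with parameter
    \<open>s n\<close>.\<close>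
  have lower: "l n \<cdot> F (?p s1) + (1 - l n) \<cdot> F (?p s0) +
      (\<Sum>k<m. tabor_weight k (s n) \<cdot> A (?u k)) \<preceq>
      s n \<cdot> F x + (1 - s n) \<cdot> F y + (\<Sum>k<m. tabor_weight k (s n) \<cdot> B (?u k))" for n
  proof -
    have weights: "tabor_weight k (s n) = l n * tabor_weight k s1 + (1 - l n) * tabor_weight k s0"
      if "k \<in> {..<m}" for k
      unfolding s_conv s0_def s1_def using that l_le[of n] \<tau>
      by (intro tabor_weight_affine_on_cell) auto
    have "l n \<cdot> F (?p s1) + (1 - l n) \<cdot> F (?p s0) +
        (\<Sum>k<m. (l n * tabor_weight k s1 + (1 - l n) * tabor_weight k s0) \<cdot> A (?u k)) \<preceq>
        (l n * s1 + (1 - l n) * s0) \<cdot> F x + (1 - (l n * s1 + (1 - l n) * s0)) \<cdot> F y +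
        (\<Sum>k<m. (l n * tabor_weight k s1 + (1 - l n) * tabor_weight k s0) \<cdot> B (?u k))"
    proof (rule dominated_convex_combination)
      show "F (?p s1) + (\<Sum>k<m. tabor_weight k s1 \<cdot> A (?u k)) \<preceq>
          s1 \<cdot> F x + (1 - s1) \<cdot> F y + (\<Sum>k<m. tabor_weight k s1 \<cdot> B (?u k))"
        unfolding s1_def by (rule jensen_dyadic[OF x y j_le])
      show "F (?p s0) + (\<Sum>k<m. tabor_weight k s0 \<cdot> A (?u k)) \<preceq>
          s0 \<cdot> F x + (1 - s0) \<cdot> F y + (\<Sum>k<m. tabor_weight k s0 \<cdot> B (?u k))"
        unfolding s0_def by (rule jensen_dyadic[OF x y]) (use j_le in simp)
    qed (use l_le[of n] \<tau> s0 s1 in \<open>auto intro!: F_convex B_convex x y diff_mem tabor_weight_nonneg\<close>)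
    then show ?thesis
      unfolding s_conv[symmetric] by (simp only: weights cong: sum.cong)
  qed

  have "asymp_dominated
      (\<lambda>n. F (?p t) + (\<Sum>k<n. tabor_weight (m + k) (s n) \<cdot> A (?u (m + k))))
      (\<lambda>n. l n \<cdot> F (?p (s1 + d n)) + (1 - l n) \<cdot> F (?p (s0 + d n)) +
        (\<Sum>k<n. tabor_weight (m + k) (s n) \<cdot> B (?u (m + k))))"
    by (rule asymp_dominatedI[OF upper])
  also have "asymp_dominated \<dots>
      (\<lambda>n. l n \<cdot> F (?p s1) + (1 - l n) \<cdot> F (?p s0) +
        (\<Sum>k<n. tabor_weight (m + k) (s n) \<cdot> B (?u (m + k))))"
    using l_le \<tau>
    by (intro asymp_dominated_add asymp_dominated_refl asymp_dominated_scale usc)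
      (auto intro: order_trans[OF _ less_imp_le])
  \<comment> \<open>The \<open>A\<close> terms of index below \<open>m\<close> are added on both
    sides, so that \<open>lower\<close> can be applied on the right.\<close>
  finally have "asymp_dominated
      (\<lambda>n. (F (?p t) + (\<Sum>k<n. tabor_weight (m + k) (s n) \<cdot> A (?u (m + k)))) +
        (\<Sum>k<m. tabor_weight k (s n) \<cdot> A (?u k)))
      (\<lambda>n. (l n \<cdot> F (?p s1) + (1 - l n) \<cdot> F (?p s0) +
        (\<Sum>k<n. tabor_weight (m + k) (s n) \<cdot> B (?u (m + k)))) +
        (\<Sum>k<m. tabor_weight k (s n) \<cdot> A (?u k)))"
    by (rule asymp_dominated_add[OF _ asymp_dominated_refl])
  also have "asymp_dominated \<dots> (\<lambda>n. (s n \<cdot> F x + (1 - s n) \<cdot> F y +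
      (\<Sum>k<m. tabor_weight k (s n) \<cdot> B (?u k))) +
      (\<Sum>k<n. tabor_weight (m + k) (s n) \<cdot> B (?u (m + k))))"
  proof (rule asymp_dominatedI, rule always_eventually, rule allI)
    fix n
    show "(l n \<cdot> F (?p s1) + (1 - l n) \<cdot> F (?p s0) +
        (\<Sum>k<n. tabor_weight (m + k) (s n) \<cdot> B (?u (m + k)))) +
        (\<Sum>k<m. tabor_weight k (s n) \<cdot> A (?u k)) \<preceq>
        (s n \<cdot> F x + (1 - s n) \<cdot> F y + (\<Sum>k<m. tabor_weight k (s n) \<cdot> B (?u k))) +
        (\<Sum>k<n. tabor_weight (m + k) (s n) \<cdot> B (?u (m + k)))"
      using dominated_add[OF lower[of n]
          dominated_refl[of "\<Sum>k<n. tabor_weight (m + k) (s n) \<cdot> B (?u (m + k))"]]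
      by (simp only: ac_simps)
  qed
  finally show ?thesis
    by (intro that[OF s_lim s_mem, of m]) (unfold sum_lessThan_add, simp only: ac_simps)
qed

text \<open>For \<open>t < 1\<close> the \<open>A\<close> sum moves from \<open>t\<close> to
  \<open>s n\<close>, the shifted dyadic inclusion applies, and coefficients and \<open>B\<close>
  sum return to \<open>t\<close>. The first and last sequences are constant, so the asymptotic
  comparison becomes domination.\<close>

lemma jensen_partial_sum:
  assumes x: "x \<in> D" and y: "y \<in> D" and t: "0 \<le> t" "t \<le> 1"
  shows "F (segment_point x y t) + (\<Sum>k=0..N. tabor_weight k t \<cdot> A ((x - y) /\<^sub>R 2 ^ k)) \<preceq>
    t \<cdot> F x + (1 - t) \<cdot> F y + tabor_transform B t (x - y)"
proof (cases "t = 1")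
  case True
  \<comment> \<open>No cell ending below 1 contains \<open>t = 1\<close>. There all weights vanish
    and \<open>F x\<close> is compared with itself.\<close>
  have weight: "tabor_weight k 1 = 0" for k
    using tabor_weight_dyadic[of k "2 ^ k"] by simp
  have zero: "0 \<cdot> A ((x - y) /\<^sub>R 2 ^ k) = 0" "0 \<cdot> B ((x - y) /\<^sub>R 2 ^ k) = 0" "0 \<cdot> F y = 0" for k
    by (intro zero_scale_set A_nonempty B_nonempty F_nonempty diff_mem x y)+
  have "tabor_transform B 1 (x - y) = closure 0"
    unfolding tabor_transform_def tabor_weight_def[symmetric] weight zero by simp
  then have "F x \<preceq> F x + tabor_transform B 1 (x - y)"
    using closure_subset[of "0 :: 'b set"]
    by (intro subset_dominated subset_set_plus_left) (auto simp: set_zero)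
  then show ?thesis
    unfolding True weight zero using zero by (simp add: segment_point_def)
next
  case False
  with t have "t < 1" by simp
  from jensen_shifted_dyadic[OF x y t(1) this] obtain m s where s: "s \<longlonglongrightarrow> t" "\<And>n. s n \<in> {0..1}"
    and main: "asymp_dominated
      (\<lambda>n. F (segment_point x y t) + (\<Sum>k<m + n. tabor_weight k (s n) \<cdot> A ((x - y) /\<^sub>R 2 ^ k)))
      (\<lambda>n. s n \<cdot> F x + (1 - s n) \<cdot> F y +
        (\<Sum>k<m + n. tabor_weight k (s n) \<cdot> B ((x - y) /\<^sub>R 2 ^ k)))"
    by blast
  have rescale: "asymp_dominated (\<lambda>n. a n \<cdot> F z) (\<lambda>n. b \<cdot> F z)"
    if "z \<in> D" "\<And>n. 0 \<le> a n" "0 \<le> b" "a \<longlonglongrightarrow> b" for z a b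
    using F_starshaped[OF that(1)] F_bounded[OF that(1)] that(2-)
    by (auto intro!: asymp_dominated_rescale LIM_zero)
  have "asymp_dominated
      (\<lambda>n. F (segment_point x y t) + (\<Sum>k=0..N. tabor_weight k t \<cdot> A ((x - y) /\<^sub>R 2 ^ k)))
      (\<lambda>n. F (segment_point x y t) + (\<Sum>k<m + n. tabor_weight k (s n) \<cdot> A ((x - y) /\<^sub>R 2 ^ k)))"
    by (intro asymp_dominated_add asymp_dominated_refl partial_sum_asymp_dominated diff_mem x y s)
  also note main
  also have "asymp_dominated
      (\<lambda>n. s n \<cdot> F x + (1 - s n) \<cdot> F y +
        (\<Sum>k<m + n. tabor_weight k (s n) \<cdot> B ((x - y) /\<^sub>R 2 ^ k)))
      (\<lambda>n. t \<cdot> F x + (1 - t) \<cdot> F y + tabor_transform B t (x - y))"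
    using s(2) t
    by (intro asymp_dominated_add rescale tabor_sum_asymp_dominated diff_mem x y s tendsto_intros)
      auto
  finally show ?thesis by (rule asymp_dominated_const)
qed

text \<open>The union in the transform of \<open>A\<close> is treated one partial sum at a time, and
  its closure is absorbed by the closed right-hand side.\<close>

lemma jensen_tabor:
  assumes x: "x \<in> D" and y: "y \<in> D" and t: "0 \<le> t" "t \<le> 1"
  shows "F (segment_point x y t) + tabor_transform A t (x - y) \<preceq>
    t \<cdot> F x + (1 - t) \<cdot> F y + tabor_transform B t (x - y)"
proof -
  let ?P = "\<Union>N. \<Sum>k=0..N. tabor_weight k t \<cdot> A ((x - y) /\<^sub>R 2 ^ k)"
  let ?R = "t \<cdot> F x + (1 - t) \<cdot> F y + tabor_transform B t (x - y)"
  have "F (segment_point x y t) + tabor_transform A t (x - y) \<subseteq>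
      closure (F (segment_point x y t)) + closure ?P"
    unfolding tabor_transform_def tabor_weight_def by (intro set_plus_mono2 closure_subset order_refl)
  also have "\<dots> \<subseteq> closure (F (segment_point x y t) + ?P)"
    by (rule closure_set_plus_subset)
  also have "\<dots> \<subseteq> closure (?R + K)"
  proof (rule closure_minimal)
    show "F (segment_point x y t) + ?P \<subseteq> closure (?R + K)"
      using jensen_partial_sum[OF assms] unfolding dominated_def set_plus_def by blast
  qed simp
  finally show ?thesis unfolding dominated_def .
qed

end

section \<open>Recession cones\<close>

lemma rec_map_zero: "0 \<in> rec_map E B"
  by (simp add: rec_map_def rec_cone_def flip: set_zero)

lemma rec_map_add:
  assumes "x \<in> rec_map E B" "y \<in> rec_map E B"
  shows "x + y \<in> rec_map E B"
  unfolding rec_map_def rec_cone_def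
proof safe
  fix u s z assume u: "u \<in> E" and s: "0 \<le> s" and "z \<in> {s *\<^sub>R (x + y)} + B u"
  then obtain b where b: "z = s *\<^sub>R (x + y) + b" "b \<in> B u" by (auto simp: set_plus_def)
  have "s *\<^sub>R y + b \<in> B u"
    using assms(2) u s b(2) by (auto simp: rec_map_def rec_cone_def set_plus_def)
  then have "s *\<^sub>R x + (s *\<^sub>R y + b) \<in> B u"
    using assms(1) u s by (fastforce simp: rec_map_def rec_cone_def set_plus_def)
  then show "z \<in> B u" by (simp add: b scaleR_add_right add.assoc)
qed

lemma rec_map_scale: "x \<in> rec_map E B \<Longrightarrow> 0 \<le> c \<Longrightarrow> c *\<^sub>R x \<in> rec_map E B"
  by (simp add: rec_map_def rec_cone_def)

lemma tvs_cone_rec_map: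
  assumes "balanced_zero_nhds_base \<U>"
  shows "tvs_cone \<U> (closure (rec_map E B))"
proof
  show "0 \<in> closure (rec_map E B)"
    using rec_map_zero closure_subset by blast
  have "closure (rec_map E B) + closure (rec_map E B) \<subseteq> closure (rec_map E B + rec_map E B)"
    by (rule closure_set_plus_subset)
  also have "\<dots> \<subseteq> closure (rec_map E B)"
    by (intro closure_mono) (auto simp: set_plus_def rec_map_add)
  finally show "x + y \<in> closure (rec_map E B)"
    if "x \<in> closure (rec_map E B)" "y \<in> closure (rec_map E B)" for x y
    using that set_plus_intro by blast
  show "c *\<^sub>R x \<in> closure (rec_map E B)" if "0 \<le> c" "x \<in> closure (rec_map E B)" for c x
  proof -
    have "c *\<^sub>R x \<in> closure (c \<cdot> rec_map E B)"
      using that(2) closure_scale_subset by blast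
    also have "\<dots> \<subseteq> closure (rec_map E B)"
      using that(1) by (intro closure_mono) (auto simp: rec_map_scale)
    finally show ?thesis .
  qed
qed (rule assms)

theorem theorem4:
  fixes D :: "'a::real_vector set"
    and A B F :: "'a \<Rightarrow> 'b::hausdorff_tvs set"
    and K :: "'b set"
    and \<U> :: "'b set set"
  assumes base: "balanced_zero_nhds_base \<U>"
    and D: "D \<noteq> {}" "convex D"
    and A_nonempty: "\<And>u. u \<in> self_difference D \<Longrightarrow> A u \<noteq> {}"
    and B_nonempty: "\<And>u. u \<in> self_difference D \<Longrightarrow> B u \<noteq> {}"
    and F_nonempty: "\<And>x. x \<in> D \<Longrightarrow> F x \<noteq> {}"
    and K: "K = closure (rec_map (self_difference D) B)"
    and jensen: "\<And>x y. x \<in> D \<Longrightarrow> y \<in> D \<Longrightarrow>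
      F ((x + y) /\<^sub>R 2) + A (x - y) \<subseteq> closure ((*\<^sub>R) (1/2) ` (F x + F y) + B (x - y))"
    and F_convex: "\<And>x. x \<in> D \<Longrightarrow> closedly_convex K (F x)"
    and F_starshaped: "\<And>x. x \<in> D \<Longrightarrow> \<exists>y. closedly_starshaped_wrt K (F x) y"
    and F_bounded: "\<And>x. x \<in> D \<Longrightarrow> closedly_lower_bounded \<U> K (F x)"
    and F_usc: "\<And>p. p \<in> D \<Longrightarrow> directionally_usc_at \<U> K D F p"
    and A_starshaped: "\<And>u. u \<in> self_difference D \<Longrightarrow> closedly_starshaped K (A u)"
    and A_bounded: "\<And>u. u \<in> self_difference D \<Longrightarrow> closedly_lower_bounded \<U> K (A u)"
    and B_starshaped: "\<And>u. u \<in> self_difference D \<Longrightarrow> closedly_starshaped K (B u)"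
    and B_bounded: "\<And>u. u \<in> self_difference D \<Longrightarrow> closedly_lower_bounded \<U> K (B u)"
    and B_convex: "\<And>u. u \<in> self_difference D \<Longrightarrow> closedly_convex K (B u)"
    and A_Cauchy: "\<And>u. u \<in> self_difference D \<Longrightarrow> serially_Cauchy \<U> K (\<lambda>k. A (u /\<^sub>R 2 ^ k))"
    and B_Cauchy: "\<And>u. u \<in> self_difference D \<Longrightarrow> serially_Cauchy \<U> K (\<lambda>k. B (u /\<^sub>R 2 ^ k))"
  shows "\<forall>x\<in>D. \<forall>y\<in>D. \<forall>t\<in>{0..1}.
    F (t *\<^sub>R x + (1 - t) *\<^sub>R y) + tabor_transform A t (x - y)
      \<subseteq> closure ((*\<^sub>R) t ` F x + (*\<^sub>R) (1 - t) ` F y + tabor_transform B t (x - y) + K)"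
proof -
  interpret tvs_cone \<U> K
    unfolding K by (rule tvs_cone_rec_map[OF base])
  interpret jensen_map \<U> K D A B F
    by unfold_locales (fact assms)+
  show ?thesis
    using jensen_tabor by (simp add: dominated_def segment_point_def)
qed

end
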